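(* Let $n\ge 2$ and let $K_n$ be the complete graph with $n$ vertices. The Smith normal forms of the $n\times n$ matrices $A^{\operatorname{trs}}(K_n)$, $D^{\deg}(K_n)$ and $L(K_n)$ are all equal to $\operatorname{diag}(1,n,\dots,n,0)$, where $n$ appears $n-2$ times. The Smith normal forms of $A^{\operatorname{trs}}_+(K_n)$, $D^{\deg}_+(K_n)$ and $Q(K_n)$ are all equal to $\operatorname{diag}(1,n-2,\dots,n-2,2(n-1)(n-2))$, where $n-2$ appears $n-2$ times.
   Context: For a connected graph $G$: $A(G)$ is the adjacency matrix; $D(G)$ is the distance matrix, with $uv$-entry the number of edges $\operatorname{dist}(u,v)$ in a shortest path between $u$ and $v$; $\deg(G)$ is the diagonal matrix of vertex degrees; $\operatorname{trs}(G)$ is the diagonal matrix of transmissions $\operatorname{trs}(u)=\sum_{v}\operatorname{dist}(u,v)$. Define $A^{\operatorname{trs}}(G)=\operatorname{trs}(G)-A(G)$, $A^{\operatorname{trs}}_+(G)=\operatorname{trs}(G)+A(G)$, $D^{\deg}(G)=\deg(G)-D(G)$, $D^{\deg}_+(G)=\deg(G)+D(G)$, $L(G)=\deg(G)-A(G)$ (Laplacian) and $Q(G)=\deg(G)+A(G)$ (signless Laplacian). The Smith normal form of a square integer matrix $M$ of size $n$ is the unique diagonal matrix $\operatorname{diag}(f_1,\dots,f_r,0,\dots,0)=PMQ'$ with $P,Q'\in GL_n(\mathbb{Z})$, $f_i$ positive integers, $f_i\mid f_{i+1}$, $r$ the rank of $M$. *)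

theory Defs
  imports "Graph_Theory.Graph_Theory" "Jordan_Normal_Form.Determinant"
begin

section \<open>Matrices of a graph\<close>

text \<open>
  As in \<^theory>\<open>Graph_Theory.Digraph\<close>, an undirected graph is a symmetric digraph without loops
  and parallel arcs, so the degree of a vertex is its out-degree.  Rows and columns are indexed by
  a list \<open>vs\<close> enumerating the vertices: the rows and columns with index \<open>i\<close> belong to
  the vertex \<open>vs ! i\<close>.
\<close>

text \<open>Meaningful only if \<open>v\<close> is reachable from \<open>u\<close>, in particular in connected graphs.\<close>

definition gdist :: "('a, 'b) pre_digraph \<Rightarrow> 'a \<Rightarrow> 'a \<Rightarrow> nat" where
  "gdist G u v = (LEAST k. \<exists>p. pre_digraph.apath G u p v \<and> length p = k)"

definition transmission :: "('a, 'b) pre_digraph \<Rightarrow> 'a \<Rightarrow> nat" where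
  "transmission G u = (\<Sum>v\<in>verts G. gdist G u v)"

definition adjacency_mat :: "('a, 'b) pre_digraph \<Rightarrow> 'a list \<Rightarrow> int mat" where
  "adjacency_mat G vs =
     mat (length vs) (length vs) (\<lambda>(i, j). if (vs ! i, vs ! j) \<in> arcs_ends G then 1 else 0)"

definition distance_mat :: "('a, 'b) pre_digraph \<Rightarrow> 'a list \<Rightarrow> int mat" where
  "distance_mat G vs =
     mat (length vs) (length vs) (\<lambda>(i, j). int (gdist G (vs ! i) (vs ! j)))"

definition degree_mat :: "('a, 'b) pre_digraph \<Rightarrow> 'a list \<Rightarrow> int mat" where
  "degree_mat G vs = mat_diag (length vs) (\<lambda>i. int (out_degree G (vs ! i)))"

definition transmission_mat :: "('a, 'b) pre_digraph \<Rightarrow> 'a list \<Rightarrow> int mat" where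
  "transmission_mat G vs = mat_diag (length vs) (\<lambda>i. int (transmission G (vs ! i)))"

definition A_trs :: "('a, 'b) pre_digraph \<Rightarrow> 'a list \<Rightarrow> int mat" where
  "A_trs G vs = transmission_mat G vs - adjacency_mat G vs"

definition A_trs_plus :: "('a, 'b) pre_digraph \<Rightarrow> 'a list \<Rightarrow> int mat" where
  "A_trs_plus G vs = transmission_mat G vs + adjacency_mat G vs"

definition D_deg :: "('a, 'b) pre_digraph \<Rightarrow> 'a list \<Rightarrow> int mat" where
  "D_deg G vs = degree_mat G vs - distance_mat G vs"

definition D_deg_plus :: "('a, 'b) pre_digraph \<Rightarrow> 'a list \<Rightarrow> int mat" where
  "D_deg_plus G vs = degree_mat G vs + distance_mat G vs"

definition laplacian_mat :: "('a, 'b) pre_digraph \<Rightarrow> 'a list \<Rightarrow> int mat" where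
  "laplacian_mat G vs = degree_mat G vs - adjacency_mat G vs"

definition signless_laplacian_mat :: "('a, 'b) pre_digraph \<Rightarrow> 'a list \<Rightarrow> int mat" where
  "signless_laplacian_mat G vs = degree_mat G vs + adjacency_mat G vs"


section \<open>Smith normal form\<close>

definition diag_of_list :: "int list \<Rightarrow> int mat" where
  "diag_of_list xs = mat_diag (length xs) (\<lambda>i. xs ! i)"

text \<open>
  The list \<open>fs\<close> is $f_1, \dots, f_r$.  That $r$ is the rank of \<open>M\<close> need not be required:
  \<open>P\<close> and \<open>Q\<close> are invertible and exactly $r$ diagonal entries of \<open>S\<close> are nonzero.
\<close>

definition is_smith_normal_form :: "int mat \<Rightarrow> int mat \<Rightarrow> bool" where
  "is_smith_normal_form M S \<longleftrightarrow>
     square_mat M \<and>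
     (\<exists>P\<in>carrier_mat (dim_row M) (dim_row M). \<exists>Q\<in>carrier_mat (dim_row M) (dim_row M).
        invertible_mat P \<and> invertible_mat Q \<and> S = P * M * Q) \<and>
     (\<exists>fs. length fs \<le> dim_row M \<and>
        S = diag_of_list (fs @ replicate (dim_row M - length fs) 0) \<and>
        (\<forall>f\<in>set fs. f > 0) \<and>
        (\<forall>i. Suc i < length fs \<longrightarrow> fs ! i dvd fs ! Suc i))"

definition smith_normal_form :: "int mat \<Rightarrow> int mat" where
  "smith_normal_form M = (THE S. is_smith_normal_form M S)"


subsection \<open>Uniqueness\<close>

text \<open>A homogeneous system of \<open>k\<close> integer equations in \<open>k + 1\<close> unknowns has a primitive solution.\<close>

lemma primitive_solution:
  fixes a :: "nat \<Rightarrow> nat \<Rightarrow> int"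
  obtains w where "\<And>i. i < k \<Longrightarrow> (\<Sum>j<Suc k. a i j * w j) = 0" "Gcd (w ` {..<Suc k}) = 1"
proof -
  define N where "N = mat (Suc k) (Suc k) (\<lambda>(i, j). if i < k then a i j else 0)"
  have N: "N \<in> carrier_mat (Suc k) (Suc k)" by (simp add: N_def)
  have "transpose_mat N *\<^sub>v unit_vec (Suc k) k = 0\<^sub>v (Suc k)"
    by (rule eq_vecI) (auto simp: N_def)
  moreover have "unit_vec (Suc k) k \<noteq> (0\<^sub>v (Suc k) :: int vec)"
    using unit_vec_nonzero[of k "Suc k"] by simp
  ultimately have "det (transpose_mat N) = 0"
    using det_0_iff_vec_prod_zero[of "transpose_mat N" "Suc k"] N
    by (meson transpose_carrier_mat unit_vec_carrier)
  then have "det N = 0" using det_transpose[OF N] by simp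
  then obtain x where x: "x \<in> carrier_vec (Suc k)" "x \<noteq> 0\<^sub>v (Suc k)" "N *\<^sub>v x = 0\<^sub>v (Suc k)"
    using det_0_iff_vec_prod_zero[OF N] by auto
  have sol: "(\<Sum>j<Suc k. a i j * x $ j) = 0" if "i < k" for i
  proof -
    have "(N *\<^sub>v x) $ i = (\<Sum>j\<in>{0..<Suc k}. a i j * x $ j)"
      using that x(1) by (auto simp: N_def scalar_prod_def intro!: sum.cong)
    then show ?thesis using that x(3) by (simp add: atLeast0LessThan)
  qed
  define c where "c = Gcd ((\<lambda>j. x $ j) ` {..<Suc k})"
  have "\<exists>j<Suc k. x $ j \<noteq> 0" using x by (metis carrier_vecD eq_vecI index_zero_vec)
  then have c0: "c \<noteq> 0" by (auto simp: c_def)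
  define w where "w j = x $ j div c" for j
  have xw: "x $ j = c * w j" if "j < Suc k" for j
    using that by (simp add: w_def c_def)
  have "(\<Sum>j<Suc k. a i j * w j) = 0" if "i < k" for i
  proof -
    have "c * (\<Sum>j<Suc k. a i j * w j) = (\<Sum>j<Suc k. a i j * x $ j)"
      unfolding sum_distrib_left by (intro sum.cong) (auto simp: xw)
    then show ?thesis using sol[OF that] c0 by (metis mult_eq_0_iff)
  qed
  moreover have "Gcd (w ` {..<Suc k}) = 1"
  proof -
    have "(\<lambda>j. x $ j) ` {..<Suc k} = (*) c ` w ` {..<Suc k}"
      unfolding image_image by (intro image_cong) (simp_all add: xw)
    then have "c = normalize (c * Gcd (w ` {..<Suc k}))"
      by (metis Gcd_mult c_def)
    moreover have "c \<ge> 0" by (simp add: c_def)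
    ultimately have "c * Gcd (w ` {..<Suc k}) = c * 1" by (simp add: abs_mult)
    then show ?thesis using c0 by simp
  qed
  ultimately show thesis by (rule that)
qed

lemma diag_equiv_dvd:
  fixes f g :: "nat \<Rightarrow> int"
  assumes U: "U \<in> carrier_mat n n" and V: "V \<in> carrier_mat n n"
    and eq: "mat_diag n g = U * mat_diag n f * V"
    and f: "\<And>i j. i \<le> j \<Longrightarrow> j < n \<Longrightarrow> f i dvd f j"
    and g: "\<And>i j. i \<le> j \<Longrightarrow> j < n \<Longrightarrow> g i dvd g j"
    and k: "k < n"
  shows "f k dvd g k"
proof -
  obtain w where w: "\<And>i. i < k \<Longrightarrow> (\<Sum>j<Suc k. V $$ (i, j) * w j) = 0"
      "Gcd (w ` {..<Suc k}) = 1"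
    using primitive_solution[of k "\<lambda>i j. V $$ (i, j)"] by blast
  have ent: "(\<Sum>m<n. U $$ (i, m) * f m * V $$ (m, j)) = (if i = j then g j else 0)"
    if "i < n" "j < n" for i j
  proof -
    have "(U * mat_diag n f * V) $$ (i, j) = (\<Sum>m\<in>{0..<n}. U $$ (i, m) * f m * V $$ (m, j))"
      unfolding mat_diag_mult_right[OF U] using that U V by (simp add: scalar_prod_def)
    moreover have "(U * mat_diag n f * V) $$ (i, j) = (if i = j then g j else 0)"
      unfolding eq[symmetric] using that by (simp add: mat_diag_def)
    ultimately show ?thesis by (simp add: atLeast0LessThan)
  qed
  have dvd: "f k dvd g k * w i" if i: "i < Suc k" for i
  proof -
    have "g i * w i = (\<Sum>j<Suc k. (if i = j then g j else 0) * w j)"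
      using i by (simp add: if_distrib[of "\<lambda>x. x * _"] sum.delta cong: if_cong)
    also have "\<dots> = (\<Sum>j<Suc k. (\<Sum>m<n. U $$ (i, m) * f m * V $$ (m, j)) * w j)"
      by (rule sum.cong[OF refl], subst ent) (use i k in auto)
    also have "\<dots> = (\<Sum>m<n. U $$ (i, m) * (f m * (\<Sum>j<Suc k. V $$ (m, j) * w j)))"
      unfolding sum_distrib_left sum_distrib_right
      by (subst sum.swap) (simp only: mult.assoc)
    finally have *: "g i * w i = \<dots>" .
    have "f k dvd f m * (\<Sum>j<Suc k. V $$ (m, j) * w j)" if "m < n" for m
      using w(1)[of m] f[of k m] that by (cases "m < k") auto
    then have "f k dvd g i * w i"
      unfolding * by - (rule dvd_sum, rule dvd_mult, simp only: lessThan_iff)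
    moreover have "g i * w i dvd g k * w i" using g[of i k] i k by (intro mult_dvd_mono) auto
    ultimately show ?thesis by (rule dvd_trans)
  qed
  have "f k dvd Gcd ((*) (g k) ` w ` {..<Suc k})"
    by (rule Gcd_greatest) (use dvd in auto)
  then show ?thesis by (simp only: Gcd_mult w(2)) simp
qed

lemma is_smith_normal_form_diag:
  assumes "is_smith_normal_form M S"
  obtains f where "S = mat_diag (dim_row M) f"
    "\<And>i j. i \<le> j \<Longrightarrow> j < dim_row M \<Longrightarrow> f i dvd f j" "\<And>i. i < dim_row M \<Longrightarrow> f i \<ge> 0"
proof -
  let ?n = "dim_row M"
  obtain fs where fs: "length fs \<le> ?n" "S = diag_of_list (fs @ replicate (?n - length fs) 0)"
      "\<forall>x\<in>set fs. x > 0" "\<And>i. Suc i < length fs \<Longrightarrow> fs ! i dvd fs ! Suc i"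
    using assms unfolding is_smith_normal_form_def by blast
  let ?f = "\<lambda>i. (fs @ replicate (?n - length fs) 0) ! i"
  have chain: "fs ! i dvd fs ! j" if "i \<le> j" "j < length fs" for i j
    using that by (induction j rule: dec_induct) (auto intro: dvd_trans fs(4))
  show thesis
  proof (rule that[of ?f])
    show "S = mat_diag ?n ?f" using fs(1,2) by (simp add: diag_of_list_def)
    show "?f i dvd ?f j" if "i \<le> j" "j < ?n" for i j
      using that chain fs(1) by (auto simp: nth_append)
    show "?f i \<ge> 0" if "i < ?n" for i
      using that fs(1,3) by (auto simp: nth_append intro: less_imp_le)
  qed
qed

lemma cancel_equiv:
  fixes M :: "int mat"
  assumes M: "M \<in> carrier_mat n n" and P: "P \<in> carrier_mat n n" and Q: "Q \<in> carrier_mat n n"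
    and P': "P' \<in> carrier_mat n n" and Q': "Q' \<in> carrier_mat n n"
    and P1: "P1 \<in> carrier_mat n n" "P1 * P = 1\<^sub>m n"
    and Q1: "Q1 \<in> carrier_mat n n" "Q * Q1 = 1\<^sub>m n"
  shows "(P' * P1) * (P * M * Q) * (Q1 * Q') = P' * M * Q'"
proof -
  note c = M P Q P' Q' P1(1) Q1(1)
  note a = assoc_mult_mat[of _ n n _ n _ n]
  have PM: "P1 * (P * X) = X" if "X \<in> carrier_mat n n" for X
    using assoc_mult_mat[OF P1(1) P that] P1(2) that by simp
  have QM: "Q * (Q1 * X) = X" if "X \<in> carrier_mat n n" for X
    using assoc_mult_mat[OF Q Q1(1) that] Q1(2) that by simp
  have "(P' * P1) * (P * M * Q) * (Q1 * Q') = P' * (P1 * (P * (M * (Q * (Q1 * Q')))))"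
    using c by (simp add: a mult_carrier_mat[of _ n n _ n])
  also have "\<dots> = P' * (M * Q')"
    using c by (simp add: PM QM mult_carrier_mat[of _ n n _ n])
  also have "\<dots> = P' * M * Q'"
    using c by (simp add: a)
  finally show ?thesis .
qed

lemma is_smith_normal_form_equiv:
  assumes "is_smith_normal_form M S" "is_smith_normal_form M S'"
  obtains U V where "U \<in> carrier_mat (dim_row M) (dim_row M)"
    "V \<in> carrier_mat (dim_row M) (dim_row M)" "S' = U * S * V"
proof -
  let ?n = "dim_row M"
  have inv: "\<exists>B\<in>carrier_mat ?n ?n. A * B = 1\<^sub>m ?n \<and> B * A = 1\<^sub>m ?n"
    if A: "A \<in> carrier_mat ?n ?n" and inv: "invertible_mat A" for A :: "int mat"
  proof -
    obtain B where B: "A * B = 1\<^sub>m (dim_row A)" "B * A = 1\<^sub>m (dim_row B)"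
      using inv by (auto simp: invertible_mat_def inverts_mat_def)
    have "dim_col B = ?n" using arg_cong[OF B(1), of dim_col] A by simp
    moreover have "dim_row B = ?n" using arg_cong[OF B(2), of dim_col] A by simp
    ultimately show ?thesis using B A by (intro bexI[of _ B]) auto
  qed
  have M: "M \<in> carrier_mat ?n ?n"
  proof -
    have "square_mat M" using assms(1) unfolding is_smith_normal_form_def by (rule conjunct1)
    then show ?thesis by (intro carrier_matI) simp_all
  qed
  from assms(1) obtain P Q where P: "P \<in> carrier_mat ?n ?n" "invertible_mat P"
    and Q: "Q \<in> carrier_mat ?n ?n" "invertible_mat Q" and S: "S = P * M * Q"
    unfolding is_smith_normal_form_def by blast
  from assms(2) obtain P' Q' where P': "P' \<in> carrier_mat ?n ?n"
    and Q': "Q' \<in> carrier_mat ?n ?n" and S': "S' = P' * M * Q'"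
    unfolding is_smith_normal_form_def by blast
  obtain P1 where P1: "P1 \<in> carrier_mat ?n ?n" "P1 * P = 1\<^sub>m ?n" using inv[OF P] by blast
  obtain Q1 where Q1: "Q1 \<in> carrier_mat ?n ?n" "Q * Q1 = 1\<^sub>m ?n" using inv[OF Q] by blast
  have "S' = (P' * P1) * S * (Q1 * Q')"
    unfolding S S' using cancel_equiv[OF M P(1) Q(1) P' Q' P1 Q1] by simp
  then show thesis using that mult_carrier_mat[OF P' P1(1)] mult_carrier_mat[OF Q1(1) Q'] by blast
qed

lemma is_smith_normal_form_unique:
  assumes S: "is_smith_normal_form M S" and S': "is_smith_normal_form M S'"
  shows "S = S'"
proof -
  let ?n = "dim_row M"
  obtain f where f: "S = mat_diag ?n f"
    "\<And>i j. i \<le> j \<Longrightarrow> j < ?n \<Longrightarrow> f i dvd f j" "\<And>i. i < ?n \<Longrightarrow> f i \<ge> 0"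
    using is_smith_normal_form_diag[OF S] by blast
  obtain g where g: "S' = mat_diag ?n g"
    "\<And>i j. i \<le> j \<Longrightarrow> j < ?n \<Longrightarrow> g i dvd g j" "\<And>i. i < ?n \<Longrightarrow> g i \<ge> 0"
    using is_smith_normal_form_diag[OF S'] by blast
  have "f k = g k" if k: "k < ?n" for k
  proof (rule zdvd_antisym_nonneg)
    obtain U V where UV: "U \<in> carrier_mat ?n ?n" "V \<in> carrier_mat ?n ?n" "S' = U * S * V"
      using is_smith_normal_form_equiv[OF S S'] .
    show "f k dvd g k"
      by (rule diag_equiv_dvd[OF UV(1,2) UV(3)[unfolded f(1) g(1)] f(2) g(2) k])
    obtain U V where UV: "U \<in> carrier_mat ?n ?n" "V \<in> carrier_mat ?n ?n" "S = U * S' * V"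
      using is_smith_normal_form_equiv[OF S' S] .
    show "g k dvd f k"
      by (rule diag_equiv_dvd[OF UV(1,2) UV(3)[unfolded f(1) g(1)] g(2) f(2) k])
  qed (rule f(3)[OF k], rule g(3)[OF k])
  then show ?thesis unfolding f(1) g(1) mat_diag_def by (intro cong_mat) auto
qed

lemma smith_normal_form_eqI: "is_smith_normal_form M S \<Longrightarrow> smith_normal_form M = S"
  unfolding smith_normal_form_def by (blast intro: is_smith_normal_form_unique)

end

theory Submission
  imports Defs
begin

text \<open>
  Distances in \<open>K\<^sub>n\<close> are 0 or 1, and every degree and every transmission is \<open>n - 1\<close>.  With \<open>J\<close> the
  all-ones matrix, the distance matrix and the adjacency matrix are therefore both \<open>J - I\<close>, and the
  degree matrix and the transmission matrix are both \<open>(n - 1) I\<close>.  So the first three matrices all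
  equal \<open>n I - J\<close> and the last three all equal \<open>(n - 2) I + J\<close>.

  Both are of the form \<open>M = c I + e J\<close> with \<open>e\<^sup>2 = 1\<close>, and they can be diagonalised together.  The row
  of \<open>M\<close> with index 0 contains units, the differences of two rows of \<open>M\<close> are \<open>c\<close> times integer vectors,
  and the combination of rows with coefficient vector \<open>p = (c + n e) u - e \<one>\<close>, where \<open>u\<close> is the first
  standard basis vector and \<open>\<one>\<close> is the all-ones vector, is \<open>c (c + n e) u\<close>: the entries of \<open>p\<close> sum to
  \<open>c\<close>, so \<open>p M = c p + c e \<one>\<close>.  This gives \<open>P M = S R\<close> with \<open>S = diag(1, c, \<dots>, c, c (c + n e))\<close> and
  explicit matrices \<open>P\<close> and \<open>R\<close>, which are triangular up to exchanging two rows and have determinant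
  1 or -1 (lemma \<open>is_smith_normal_form_scalar_plus_ones\<close>).  Then \<open>S = P M R\<^sup>-\<^sup>1\<close>, and \<open>c (c + n e)\<close>
  is \<open>0\<close> for \<open>c = n\<close>, \<open>e = -1\<close> and \<open>2 (n - 1) (n - 2)\<close> for \<open>c = n - 2\<close>, \<open>e = 1\<close>.
\<close>

section \<open>Smith normal forms from unimodular factorizations\<close>

lemma unit_det_inverse:
  fixes A :: "'a::comm_ring_1 mat"
  assumes A: "A \<in> carrier_mat n n" and unit: "det A dvd 1"
  obtains B where "B \<in> carrier_mat n n" "A * B = 1\<^sub>m n" "B * A = 1\<^sub>m n"
proof -
  obtain u where u: "1 = det A * u" using unit by (auto elim: dvdE)
  let ?B = "u \<cdot>\<^sub>m adj_mat A"
  have "?B \<in> carrier_mat n n" using adj_mat(1)[OF A] by simp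
  moreover have "A * ?B = 1\<^sub>m n"
    using mult_smult_distrib[OF A adj_mat(1)[OF A], of u] adj_mat(2)[OF A] u
    by (auto intro!: eq_matI simp: mult.commute)
  moreover have "?B * A = 1\<^sub>m n"
    using mult_smult_assoc_mat[OF adj_mat(1)[OF A] A, of u] adj_mat(3)[OF A] u
    by (auto intro!: eq_matI simp: mult.commute)
  ultimately show thesis by (rule that)
qed

lemma invertible_matI:
  assumes "A \<in> carrier_mat n n" "B \<in> carrier_mat n n" "A * B = 1\<^sub>m n" "B * A = 1\<^sub>m n"
  shows "invertible_mat A"
  using assms by (auto simp: invertible_mat_def inverts_mat_def)

text \<open>
  Since 0 divides only 0, the zeros of a divisibility chain form its tail, as the shape of a Smith
  normal form demands.
\<close>

lemma dvd_chain_zeros_last: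
  fixes xs :: "'a::comm_semiring_1 list"
  assumes "sorted_wrt (dvd) xs"
  defines "fs \<equiv> takeWhile (\<lambda>x. x \<noteq> 0) xs"
  shows "xs = fs @ replicate (length xs - length fs) 0"
  using assms(1) unfolding fs_def
proof (induction xs)
  case (Cons x xs)
  show ?case
  proof (cases "x = 0")
    case True
    then have "\<forall>y\<in>set xs. y = 0" using Cons.prems by simp
    then show ?thesis using True by (simp add: replicate_length_same)
  qed (use Cons in simp)
qed simp

text \<open>
  Verifying \<open>P M = S R\<close> instead of \<open>S = P M Q\<close> avoids computing the inverse \<open>Q\<close> of \<open>R\<close>.
\<close>

lemma is_smith_normal_formI:
  assumes M: "M \<in> carrier_mat n n"
    and P: "P \<in> carrier_mat n n" "det P dvd 1"
    and R: "R \<in> carrier_mat n n" "det R dvd 1"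
    and eq: "P * M = diag_of_list xs * R"
    and xs: "length xs = n" "sorted_wrt (dvd) xs" "\<forall>x\<in>set xs. x \<ge> 0"
  shows "is_smith_normal_form M (diag_of_list xs)"
proof -
  obtain P' where P': "P' \<in> carrier_mat n n" "P * P' = 1\<^sub>m n" "P' * P = 1\<^sub>m n"
    using unit_det_inverse[OF P] .
  obtain Q where Q: "Q \<in> carrier_mat n n" "R * Q = 1\<^sub>m n" "Q * R = 1\<^sub>m n"
    using unit_det_inverse[OF R] .
  have S: "diag_of_list xs \<in> carrier_mat n n"
    using xs(1) by (simp add: diag_of_list_def)
  have "P * M * Q = diag_of_list xs"
    unfolding eq assoc_mult_mat[OF S R(1) Q(1)] Q(2) using S by simp
  moreover have "invertible_mat P" "invertible_mat Q"
    using invertible_matI[OF P(1) P'] invertible_matI[OF Q(1) R(1) Q(3,2)] by auto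
  ultimately have equiv: "\<exists>P\<in>carrier_mat n n. \<exists>Q\<in>carrier_mat n n.
      invertible_mat P \<and> invertible_mat Q \<and> diag_of_list xs = P * M * Q"
    using P(1) Q(1) by metis
  define fs where "fs = takeWhile (\<lambda>x. x \<noteq> 0) xs"
  have split: "xs = fs @ replicate (n - length fs) 0"
    using dvd_chain_zeros_last[OF xs(2)] xs(1) by (simp add: fs_def)
  have "length fs \<le> n" using xs(1) length_takeWhile_le unfolding fs_def by metis
  moreover have "\<forall>f\<in>set fs. f > 0"
    using xs(3) by (fastforce simp: fs_def dest: set_takeWhileD)
  moreover have "fs ! i dvd fs ! Suc i" if "Suc i < length fs" for i
  proof -
    have "sorted_wrt (dvd) fs" using xs(2) split by (metis sorted_wrt_append)
    then show ?thesis using that by (simp add: sorted_wrt_nth_less)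
  qed
  ultimately show ?thesis
    unfolding is_smith_normal_form_def using equiv split M
    by (intro conjI exI[of _ fs]) auto
qed


section \<open>Scalar matrices plus or minus the all-ones matrix\<close>

definition scalar_plus_ones :: "nat \<Rightarrow> int \<Rightarrow> int \<Rightarrow> int mat" where
  "scalar_plus_ones n c e = mat n n (\<lambda>(i, j). (if i = j then c else 0) + e)"

lemma mult_scalar_plus_ones:
  assumes P: "P \<in> carrier_mat n n" and ij: "i < n" "j < n"
  shows "(P * scalar_plus_ones n c e) $$ (i, j) = c * P $$ (i, j) + e * (\<Sum>m<n. P $$ (i, m))"
proof -
  have "(P * scalar_plus_ones n c e) $$ (i, j) =
      (\<Sum>m<n. P $$ (i, m) * ((if m = j then c else 0) + e))"
    using P ij by (auto simp: scalar_plus_ones_def scalar_prod_def atLeast0LessThan intro!: sum.cong)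
  also have "\<dots> = (\<Sum>m<n. P $$ (i, m) * (if m = j then c else 0)) + (\<Sum>m<n. P $$ (i, m) * e)"
    by (simp add: distrib_left sum.distrib)
  also have "(\<Sum>m<n. P $$ (i, m) * (if m = j then c else 0)) = c * P $$ (i, j)"
    using ij by (simp add: if_distrib cong: if_cong)
  also have "(\<Sum>m<n. P $$ (i, m) * e) = e * (\<Sum>m<n. P $$ (i, m))"
    by (simp add: sum_distrib_left mult.commute)
  finally show ?thesis .
qed

lemma det_lower_triangular_unit:
  fixes A :: "'a::comm_ring_1 mat"
  assumes "A \<in> carrier_mat n n" "\<And>i j. i < j \<Longrightarrow> j < n \<Longrightarrow> A $$ (i, j) = 0"
    and "\<And>i. i < n \<Longrightarrow> A $$ (i, i) dvd 1"
  shows "det A dvd 1"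
proof -
  have "det A = (\<Prod>i<n. A $$ (i, i))"
    using det_lower_triangular[OF assms(2,1)] assms(1)
    by (simp add: prod_list_diag_prod atLeast0LessThan)
  moreover have "(\<Prod>i\<in>I. A $$ (i, i)) dvd 1" if "I \<subseteq> {..<n}" for I
    using finite_subset[OF that finite_lessThan] that
  proof (induction I)
    case (insert i I)
    then show ?case using mult_dvd_mono[of "A $$ (i, i)" 1 _ 1] assms(3) by simp
  qed simp
  ultimately show ?thesis by simp
qed

text \<open>
  Row 0 of \<open>P\<close> rescales row 0 of the matrix so that its off-diagonal entries become 1, the middle
  rows subtract row 0 from the other rows, and the last row is the combination \<open>p\<close> from the
  introduction.  The diagonal entries 1, \<open>c\<close> and \<open>c (c + n e)\<close> factor out of the resulting rows and
  leave the rows of \<open>R\<close>: \<open>(1 + e c, 1, \<dots>, 1)\<close>, then each middle standard basis vector minus the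
  first one, then the first one itself.  Exchanging the first and last rows of \<open>R\<close>
  gives the lower triangular matrix \<open>L\<close>.
\<close>

lemma is_smith_normal_form_scalar_plus_ones:
  assumes n: "n \<ge> 2" and c: "c \<ge> 0" and e: "e * e = 1" and nonneg: "c + int n * e \<ge> 0"
  shows "is_smith_normal_form (scalar_plus_ones n c e)
    (diag_of_list ([1] @ replicate (n - 2) c @ [c * (c + int n * e)]))"
proof -
  define d where "d = c + int n * e"
  define xs where "xs = [1] @ replicate (n - 2) c @ [c * d]"
  define P where "P = mat n n (\<lambda>(i, j).
    if i = 0 then if j = 0 then e else 0
    else if i < n - 1 then (if j = i then 1 else 0) - (if j = 0 then 1 else 0)
    else (if j = 0 then d else 0) - e)"
  define L where "L = mat n n (\<lambda>(i, j).
    if i = 0 then if j = 0 then 1 else 0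
    else if i < n - 1 then (if j = i then 1 else 0) - (if j = 0 then 1 else 0)
    else (if j = 0 then e * c else 0) + (1 :: int))"
  define R where "R = swaprows 0 (n - 1) L"
  have M: "scalar_plus_ones n c e \<in> carrier_mat n n" by (simp add: scalar_plus_ones_def)
  have P: "P \<in> carrier_mat n n" and L: "L \<in> carrier_mat n n"
    by (simp_all add: P_def L_def)
  then have R: "R \<in> carrier_mat n n" by (simp add: R_def)
  have e_unit: "e dvd 1" using e by (metis dvd_triv_left)
  have detP: "det P dvd 1"
    by (rule det_lower_triangular_unit[OF P]) (use n e_unit in \<open>auto simp: P_def\<close>)
  have "det L dvd 1"
    by (rule det_lower_triangular_unit[OF L]) (use n in \<open>auto simp: L_def\<close>)
  then have detR: "det R dvd 1"
    using det_swaprows[OF _ _ _ L, of 0 "n - 1"] n by (simp add: R_def)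
  have len: "length xs = n" using n by (simp add: xs_def)
  have nth: "xs ! i = (if i = 0 then 1 else if i < n - 1 then c else c * d)" if "i < n" for i
    using that n by (auto simp: xs_def nth_append nth_Cons')
  have row_sum: "(\<Sum>m<n. P $$ (i, m)) = (if i = 0 then e else if i < n - 1 then 0 else c)"
    if "i < n" for i
    using that n by (auto simp: P_def sum_subtractf d_def)
  have "P * scalar_plus_ones n c e = diag_of_list xs * R"
  proof (rule eq_matI)
    fix i j assume "i < dim_row (diag_of_list xs * R)" "j < dim_col (diag_of_list xs * R)"
    then have ij: "i < n" "j < n" using R len by (simp_all add: diag_of_list_def mat_diag_def)
    have "(diag_of_list xs * R) $$ (i, j) = xs ! i * R $$ (i, j)"
      using ij mat_diag_mult_left[OF R, of "\<lambda>i. xs ! i"] by (simp add: diag_of_list_def len)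
    moreover have "(P * scalar_plus_ones n c e) $$ (i, j) = xs ! i * R $$ (i, j)"
      unfolding mult_scalar_plus_ones[OF P ij] nth[OF ij(1)] row_sum[OF ij(1)]
      using n ij e by (auto simp: R_def P_def L_def algebra_simps)
    ultimately show "(P * scalar_plus_ones n c e) $$ (i, j) = (diag_of_list xs * R) $$ (i, j)"
      by simp
  qed (use P R len in \<open>simp_all add: diag_of_list_def scalar_plus_ones_def mat_diag_def\<close>)
  moreover have "sorted_wrt (dvd) xs"
    using nth by (auto simp: sorted_wrt_iff_nth_less len)
  moreover have "\<forall>x\<in>set xs. x \<ge> 0"
    using c nonneg by (auto simp: xs_def d_def)
  ultimately show ?thesis
    using is_smith_normal_formI[OF M P detP R detR _ len] by (simp add: xs_def d_def)
qed


section \<open>The matrices of a complete graph\<close>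

lemma out_degree_complete:
  assumes K: "complete_digraph n K" and u: "u \<in> verts K"
  shows "out_degree K u = n - 1"
proof -
  interpret graph K using K by (simp add: complete_digraph_def)
  have ends: "arcs_ends K = {(u, v). (u, v) \<in> verts K \<times> verts K \<and> u \<noteq> v}"
    and card: "card (verts K) = n"
    using K by (simp_all add: complete_digraph_def)
  have "arc_to_ends K ` out_arcs K u = {p \<in> arcs_ends K. fst p = u}"
    by (auto simp: out_arcs_def arcs_ends_def arc_to_ends_def)
  also have "\<dots> = Pair u ` (verts K - {u})"
    using u by (auto simp: ends)
  finally have img: "arc_to_ends K ` out_arcs K u = Pair u ` (verts K - {u})" .
  \<comment> \<open>There are no parallel arcs, so the arcs leaving \<open>u\<close> are counted by their end points.\<close>
  have "inj_on (arc_to_ends K) (out_arcs K u)"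
    by (rule inj_on_subset[OF inj_on_arc_to_ends]) (auto simp: out_arcs_def)
  then have "out_degree K u = card (Pair u ` (verts K - {u}))"
    unfolding out_degree_def img[symmetric] by (simp add: card_image)
  also have "\<dots> = n - 1"
    using u card by (simp add: card_image inj_on_def)
  finally show ?thesis .
qed

lemma gdist_complete:
  assumes K: "complete_digraph n K" and u: "u \<in> verts K" and v: "v \<in> verts K"
  shows "gdist K u v = (if u = v then 0 else 1)"
proof -
  interpret graph K using K by (simp add: complete_digraph_def)
  have nil: "(\<exists>p. apath u p v \<and> length p = 0) \<longleftrightarrow> u = v"
    using u by (auto simp: apath_Nil_iff)
  show ?thesis
  proof (cases "u = v")
    case True
    then show ?thesis unfolding gdist_def using nil by (intro Least_equality) auto
  next
    case False
    then have "(u, v) \<in> arcs_ends K"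
      using K u v by (simp add: complete_digraph_def)
    then obtain a where "a \<in> arcs K" "tail K a = u" "head K a = v"
      by (auto simp: arcs_ends_def arc_to_ends_def)
    then have "apath u [a] v" using False u v
      by (simp add: apath_Cons_iff apath_Nil_iff)
    then have "\<exists>p. apath u p v \<and> length p = 1" by (intro exI[of _ "[a]"]) simp
    then have "gdist K u v = 1"
      unfolding gdist_def using nil False
      by (intro Least_equality) (simp_all add: Suc_le_eq, metis gr0I length_0_conv)
    then show ?thesis using False by simp
  qed
qed

lemma transmission_complete:
  assumes K: "complete_digraph n K" and u: "u \<in> verts K"
  shows "transmission K u = n - 1"
proof -
  interpret graph K using K by (simp add: complete_digraph_def)
  have "transmission K u = (\<Sum>v\<in>verts K. if u = v then 0 else 1)"
    unfolding transmission_def using gdist_complete[OF K u] by (intro sum.cong) auto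
  also have "\<dots> = (\<Sum>v\<in>verts K - {u}. 1)"
    by (rule sum.mono_neutral_cong_right) auto
  also have "\<dots> = n - 1"
    using K u by (simp add: complete_digraph_def)
  finally show ?thesis .
qed

lemma complete_digraph_matrices:
  assumes K: "complete_digraph n K" and vs: "distinct vs" "set vs = verts K"
  shows "adjacency_mat K vs = scalar_plus_ones n (- 1) 1"
    and "distance_mat K vs = scalar_plus_ones n (- 1) 1"
    and "degree_mat K vs = mat_diag n (\<lambda>_. int (n - 1))"
    and "transmission_mat K vs = mat_diag n (\<lambda>_. int (n - 1))"
proof -
  have len: "length vs = n"
    using K vs distinct_card[OF vs(1)] by (simp add: complete_digraph_def)
  have vert: "vs ! i \<in> verts K" if "i < n" for i
    using that len vs(2) nth_mem by metis
  have eq: "vs ! i = vs ! j \<longleftrightarrow> i = j" if "i < n" "j < n" for i j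
    using that len vs(1) by (simp add: nth_eq_iff_index_eq)
  have arc: "(vs ! i, vs ! j) \<in> arcs_ends K \<longleftrightarrow> i \<noteq> j" if "i < n" "j < n" for i j
    using K vert that eq by (simp add: complete_digraph_def)
  show "adjacency_mat K vs = scalar_plus_ones n (- 1) 1"
    unfolding adjacency_mat_def scalar_plus_ones_def len
    by (intro cong_mat) (auto simp: arc)
  show "distance_mat K vs = scalar_plus_ones n (- 1) 1"
    unfolding distance_mat_def scalar_plus_ones_def len
    by (intro cong_mat) (auto simp: gdist_complete[OF K vert vert] eq)
  show "degree_mat K vs = mat_diag n (\<lambda>_. int (n - 1))"
    unfolding degree_mat_def mat_diag_def len
    by (intro cong_mat) (auto simp: out_degree_complete[OF K vert])
  show "transmission_mat K vs = mat_diag n (\<lambda>_. int (n - 1))"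
    unfolding transmission_mat_def mat_diag_def len
    by (intro cong_mat) (auto simp: transmission_complete[OF K vert])
qed

theorem proposition3p11:
  fixes n :: nat and K :: "('a, 'b) pre_digraph" and vs :: "'a list"
  assumes "n \<ge> 2" and "complete_digraph n K"
    and "distinct vs" and "set vs = verts K"
  shows
   "smith_normal_form (A_trs K vs) =
      diag_of_list ([1] @ replicate (n - 2) (int n) @ [0]) \<and>
    smith_normal_form (D_deg K vs) =
      diag_of_list ([1] @ replicate (n - 2) (int n) @ [0]) \<and>
    smith_normal_form (laplacian_mat K vs) =
      diag_of_list ([1] @ replicate (n - 2) (int n) @ [0]) \<and>
    smith_normal_form (A_trs_plus K vs) =
      diag_of_list ([1] @ replicate (n - 2) (int n - 2) @ [2 * (int n - 1) * (int n - 2)]) \<and>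
    smith_normal_form (D_deg_plus K vs) =
      diag_of_list ([1] @ replicate (n - 2) (int n - 2) @ [2 * (int n - 1) * (int n - 2)]) \<and>
    smith_normal_form (signless_laplacian_mat K vs) =
      diag_of_list ([1] @ replicate (n - 2) (int n - 2) @ [2 * (int n - 1) * (int n - 2)])"
proof -
  have minus: "mat_diag n (\<lambda>_. int (n - 1)) - scalar_plus_ones n (- 1) 1 =
      scalar_plus_ones n (int n) (- 1)"
    and plus: "mat_diag n (\<lambda>_. int (n - 1)) + scalar_plus_ones n (- 1) 1 =
      scalar_plus_ones n (int n - 2) 1"
    using \<open>n \<ge> 2\<close> by (auto intro!: eq_matI simp: mat_diag_def scalar_plus_ones_def of_nat_diff)
  have snf_minus: "smith_normal_form (scalar_plus_ones n (int n) (- 1)) =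
      diag_of_list ([1] @ replicate (n - 2) (int n) @ [0])"
    using is_smith_normal_form_scalar_plus_ones[of n "int n" "- 1"] \<open>n \<ge> 2\<close>
    by (intro smith_normal_form_eqI) simp
  have last_entry: "(int n - 2) * (int n - 2 + int n * 1) = 2 * (int n - 1) * (int n - 2)"
    by (simp add: algebra_simps)
  have snf_plus: "smith_normal_form (scalar_plus_ones n (int n - 2) 1) =
      diag_of_list ([1] @ replicate (n - 2) (int n - 2) @ [2 * (int n - 1) * (int n - 2)])"
    using is_smith_normal_form_scalar_plus_ones[of n "int n - 2" 1, unfolded last_entry] \<open>n \<ge> 2\<close>
    by (intro smith_normal_form_eqI) simp
  show ?thesis
    unfolding A_trs_def D_deg_def laplacian_mat_def A_trs_plus_def D_deg_plus_def
      signless_laplacian_mat_def complete_digraph_matrices[OF assms(2-4)] minus plus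
    using snf_minus snf_plus by simp
qed

end
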